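(* Let $N$ be a Poisson process with rate $\lambda>0$, independent of the i.i.d. positive random variables $W(k)$, $k\ge1$, and assume $W(1)$ is regularly varying with index $-\beta<-1$ (i.e. $x\mapsto\mathbb P(W(1)>x)$ is regularly varying at infinity with index $-\beta$). Let $\gamma>0$ and $l^*\in\mathbb Z_+$, and for integers $n\ge1$ let $B_n^\gamma=\{\#\{k\le N(n):W(k)>n\gamma\}\ge l^*\}$. For $m\ge l^*$ put $$h_m(n)=\mathbb P(N(n)=m\mid B_n^\gamma),\qquad M_m(n)=\frac{\binom{m}{l^*}\mathbb P(W(1)>n\gamma)^{l^*}}{\mathbb P(B_n^\gamma\mid N(n)=m)}.$$ Then the expected running time $T(n)=\sum_{m\ge l^*}h_m(n)M_m(n)$ of the rejection sampling algorithm (described in the context) for generating $(N(n),W(1),\dots,W(N(n)))$ conditionally on $B_n^\gamma$ is uniformly bounded in $n$: $\sup_{n\ge1}T(n)<\infty$.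
   Context: The algorithm: first sample $m$ with probability $h_m(n)$. Then repeat the following until acceptance: (1) sample an $l^*$-element subset $\{b_1,\dots,b_{l^*}\}$ uniformly from all $l^*$-element subsets of $\{1,\dots,m\}$; (2) independently sample $W(b_k)$, $k\le l^*$, from the law of $W(1)$ conditional on $W(1)>n\gamma$, and sample $W(j)$ for $j\in\{1,\dots,m\}\setminus\{b_1,\dots,b_{l^*}\}$ from the law of $W(1)$; (3) accept with probability $\binom{c}{l^*}^{-1}$, where $c=\#\{j\le m:W(j)>n\gamma\}$. Running time is measured by the number of proposals (iterations of (1)-(3)); given $m$, the expected number of proposals is $M_m(n)$, so the expected running time is $T(n)=\sum_{m\ge l^*}h_m(n)M_m(n)$. In the paper, the algorithm produces the sample path of the scaled compensated compound Poisson process $\bar X_n(t)=\frac1n\big(\sum_{k=1}^{N(nt)}W(k)-\lambda nt\,\mathbb EW(1)\big)$ conditional on it having at least $l^*$ jumps larger than $\gamma$ on $[0,1]$. *)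

theory Defs
  imports "HOL-Probability.Probability"
begin

definition regularly_varying :: "(real \<Rightarrow> real) \<Rightarrow> real \<Rightarrow> bool" where
  "regularly_varying f \<rho> \<longleftrightarrow>
     (\<exists>a. (\<forall>x\<ge>a. 0 < f x) \<and> f \<in> borel_measurable (restrict_space borel {a..})) \<and>
     (\<forall>t>0. ((\<lambda>x. f (t * x) / f x) \<longlongrightarrow> t powr \<rho>) at_top)"

text \<open>The truncated subtraction of naturals in the increments is harmless, because almost all
  paths are nondecreasing.\<close>

definition poisson_process :: "'a measure \<Rightarrow> real \<Rightarrow> (real \<Rightarrow> 'a \<Rightarrow> nat) \<Rightarrow> bool" where
  "poisson_process M rate N \<longleftrightarrow>
     (\<forall>t\<ge>0. N t \<in> measurable M (count_space UNIV)) \<and>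
     (AE \<omega> in M. N 0 \<omega> = 0 \<and> mono_on {0..} (\<lambda>t. N t \<omega>) \<and>
        (\<forall>t\<ge>0. continuous (at_right t) (\<lambda>s. real (N s \<omega>)))) \<and>
     (\<forall>s t. 0 \<le> s \<longrightarrow> s < t \<longrightarrow>
        distr M (count_space UNIV) (\<lambda>\<omega>. N t \<omega> - N s \<omega>) = measure_pmf (poisson_pmf (rate * (t - s)))) \<and>
     (\<forall>(k::nat) t. 0 \<le> t 0 \<longrightarrow> (\<forall>i<k. t i < t (Suc i)) \<longrightarrow>
        prob_space.indep_vars M (\<lambda>_. count_space UNIV)
          (\<lambda>i \<omega>. N (t (Suc i)) \<omega> - N (t i) \<omega>) {..<k})"

definition large_jumps_event ::
  "'a measure \<Rightarrow> (real \<Rightarrow> 'a \<Rightarrow> nat) \<Rightarrow> (nat \<Rightarrow> 'a \<Rightarrow> real) \<Rightarrow> real \<Rightarrow> nat \<Rightarrow> nat \<Rightarrow> 'a set" where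
  "large_jumps_event M N W \<gamma> l n =
     {\<omega> \<in> space M. l \<le> card {k \<in> {1..N (real n) \<omega>}. real n * \<gamma> < W k \<omega>}}"

definition jump_count_weight ::
  "'a measure \<Rightarrow> (real \<Rightarrow> 'a \<Rightarrow> nat) \<Rightarrow> (nat \<Rightarrow> 'a \<Rightarrow> real) \<Rightarrow> real \<Rightarrow> nat \<Rightarrow> nat \<Rightarrow> nat \<Rightarrow> real" where
  "jump_count_weight M N W \<gamma> l n m =
     \<P>(\<omega> in M. N (real n) \<omega> = m \<bar> \<omega> \<in> large_jumps_event M N W \<gamma> l n)"

definition mean_proposals ::
  "'a measure \<Rightarrow> (real \<Rightarrow> 'a \<Rightarrow> nat) \<Rightarrow> (nat \<Rightarrow> 'a \<Rightarrow> real) \<Rightarrow> real \<Rightarrow> nat \<Rightarrow> nat \<Rightarrow> nat \<Rightarrow> real" where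
  "mean_proposals M N W \<gamma> l n m =
     real (m choose l) * \<P>(\<omega> in M. real n * \<gamma> < W 1 \<omega>) ^ l /
     \<P>(\<omega> in M. \<omega> \<in> large_jumps_event M N W \<gamma> l n \<bar> N (real n) \<omega> = m)"

text \<open>The sum is taken in \<^typ>\<open>ennreal\<close>, so that divergence gives \<open>\<infinity>\<close> rather than the value \<open>0\<close> that
  the sum of a non-summable real family has by convention.\<close>

definition mean_running_time ::
  "'a measure \<Rightarrow> (real \<Rightarrow> 'a \<Rightarrow> nat) \<Rightarrow> (nat \<Rightarrow> 'a \<Rightarrow> real) \<Rightarrow> real \<Rightarrow> nat \<Rightarrow> nat \<Rightarrow> ennreal" where
  "mean_running_time M N W \<gamma> l n =
     (\<Sum>\<^sub>\<infinity>m\<in>{l..}. ennreal (jump_count_weight M N W \<gamma> l n m * mean_proposals M N W \<gamma> l n m))"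

text \<open>The rejection sampler itself, for a jump size law \<open>\<mu>\<close>, a threshold \<open>u\<close> (here \<open>n\<gamma>\<close>) and a given
  number \<open>m\<close> of jumps. First the law of a proposed vector of jump sizes, then that of the
  accept/reject decision of one proposal. The law of a jump conditional on exceeding \<open>u\<close> is
  \<^term>\<open>uniform_measure \<mu> {u<..}\<close>, whose density with respect to \<open>\<mu>\<close> is proportional to the
  indicator of \<^term>\<open>{u<..}\<close>.\<close>

definition proposal :: "real measure \<Rightarrow> real \<Rightarrow> nat \<Rightarrow> nat \<Rightarrow> (nat \<Rightarrow> real) measure" where
  "proposal \<mu> u l m =
     measure_pmf (pmf_of_set {b. b \<subseteq> {1..m} \<and> card b = l}) \<bind>
       (\<lambda>b. \<Pi>\<^sub>M j\<in>{1..m}. (if j \<in> b then uniform_measure \<mu> {u<..} else \<mu>))"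

definition accepted :: "real measure \<Rightarrow> real \<Rightarrow> nat \<Rightarrow> nat \<Rightarrow> bool measure" where
  "accepted \<mu> u l m =
     proposal \<mu> u l m \<bind>
       (\<lambda>w. measure_pmf (bernoulli_pmf (1 / real (card {j \<in> {1..m}. u < w j} choose l))))"

definition num_proposals :: "(nat \<Rightarrow> bool) \<Rightarrow> enat" where
  "num_proposals s = (if \<exists>k. s k then enat (Suc (LEAST k. s k)) else \<infinity>)"

text \<open>Expected number of proposals of the whole algorithm: \<open>m\<close> is drawn with the weights \<open>h\<^sub>m(n)\<close>, and
  then independent proposals are made until the first acceptance.\<close>

definition sampler_expected_proposals ::
  "'a measure \<Rightarrow> (real \<Rightarrow> 'a \<Rightarrow> nat) \<Rightarrow> (nat \<Rightarrow> 'a \<Rightarrow> real) \<Rightarrow> real \<Rightarrow> nat \<Rightarrow> nat \<Rightarrow> ennreal" where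
  "sampler_expected_proposals M N W \<gamma> l n =
     (\<integral>\<^sup>+m. (\<integral>\<^sup>+s. ennreal_of_enat (num_proposals s)
               \<partial>(\<Pi>\<^sub>M i\<in>(UNIV :: nat set). accepted (distr M borel (W 1)) (real n * \<gamma>) l m))
        \<partial>point_measure {l..} (\<lambda>m. ennreal (jump_count_weight M N W \<gamma> l n m)))"

end

theory Submission
  imports Defs
begin

(* Write p for the tail probability P(W(1) > n gamma), r for rate * n and B for the conditioning
   event. One proposal given m jumps is accepted with probability P(B | N(n) = m) / (C(m,l) p^l), so
   M_m is the mean of a geometric variable, and in h_m M_m the conditional probabilities of B
   cancel: h_m M_m = P(N(n) = m) C(m,l) p^l / P(B). Summing over m gives T(n) = (r p)^l / l! / P(B).
   Having exactly l large jumps has probability exp(-r p) (r p)^l / l! by Poisson thinning, hence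
   T(n) <= exp(r p). Finally n p is bounded because beta > 1. *)

text \<open>For fixed n and l > 0 the numbers M_m are unbounded in m: C(m,l) p^l grows without
  bound, while the conditional probability in the denominator stays at most 1. A bound uniform in m
  is therefore impossible, and the estimate has to come from averaging with the weights h_m. What
  the average computes is visible from the number Z of large jumps, which is Poisson with mean r p:
  the numerator of T(n) is the binomial moment E C(Z,l), the denominator is P(Z >= l). The law of Z
  is never constructed; both quantities are reached through series over m that are compared term by
  term. The estimate holds for each n separately, so p must be positive for every n, and n p bounded
  over all n, whereas regular variation speaks about large arguments. Monotonicity of the tail and
  its bound by 1 close this gap.\<close>

section \<open>Auxiliary facts: product densities, waiting times, Poisson series, regular
  variation\<close>

text \<open>Both measures agree on boxes, by Tonelli. This expresses the proposal laws for different
  subsets \<open>b\<close> as densities against one common measure, so that their integrals can be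
  added under a single integral sign.\<close>

lemma (in product_sigma_finite) PiM_density:
  assumes "finite I"
    and f [measurable]: "\<And>i. i \<in> I \<Longrightarrow> f i \<in> borel_measurable (M i)"
    and sf: "\<And>i. sigma_finite_measure (density (M i) (f i))"
  shows "PiM I (\<lambda>i. density (M i) (f i)) = density (PiM I M) (\<lambda>x. \<Prod>i\<in>I. f i (x i))"
proof -
  interpret D: product_sigma_finite "\<lambda>i. density (M i) (f i)"
    by (rule product_sigma_finite.intro) (rule sf)
  have meas: "(\<lambda>x. \<Prod>i\<in>I. f i (x i)) \<in> borel_measurable (PiM I M)"
    by measurable
  show ?thesis
  proof (rule D.PiM_eqI [symmetric])
    fix A assume "\<And>i. i \<in> I \<Longrightarrow> A i \<in> sets (density (M i) (f i))"
    then have A [measurable]: "\<And>i. i \<in> I \<Longrightarrow> A i \<in> sets (M i)" by simp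
    have "emeasure (density (PiM I M) (\<lambda>x. \<Prod>i\<in>I. f i (x i))) (Pi\<^sub>E I A) =
        (\<integral>\<^sup>+x. (\<Prod>i\<in>I. f i (x i)) * indicator (Pi\<^sub>E I A) x \<partial>PiM I M)"
      using \<open>finite I\<close> A meas by (intro emeasure_density sets_PiM_I_finite) auto
    also have "\<dots> = (\<integral>\<^sup>+x. (\<Prod>i\<in>I. f i (x i) * indicator (A i) (x i)) \<partial>PiM I M)"
    proof (rule nn_integral_cong)
      fix x assume "x \<in> space (PiM I M)"
      then have "x \<in> extensional I" by (auto simp: space_PiM PiE_def)
      then have "indicator (Pi\<^sub>E I A) x = (\<Prod>i\<in>I. indicator (A i) (x i) :: ennreal)"
        using \<open>finite I\<close> by (auto simp: indicator_def PiE_def Pi_iff prod_zero_iff)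
      then show "(\<Prod>i\<in>I. f i (x i)) * indicator (Pi\<^sub>E I A) x =
          (\<Prod>i\<in>I. f i (x i) * indicator (A i) (x i))"
        by (simp add: prod.distrib)
    qed
    also have "\<dots> = (\<Prod>i\<in>I. \<integral>\<^sup>+x. f i x * indicator (A i) x \<partial>M i)"
      using \<open>finite I\<close> A by (intro product_nn_integral_prod borel_measurable_times f) auto
    also have "\<dots> = (\<Prod>i\<in>I. emeasure (density (M i) (f i)) (A i))"
      using A f by (intro prod.cong refl emeasure_density [symmetric]) auto
    finally show "emeasure (density (PiM I M) (\<lambda>x. \<Prod>i\<in>I. f i (x i))) (Pi\<^sub>E I A) =
        (\<Prod>i\<in>I. emeasure (density (M i) (f i)) (A i))" .
  qed (use \<open>finite I\<close> in \<open>auto intro!: sets_PiM_cong\<close>)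
qed

text \<open>Tail-sum formula: the term with index \<open>k\<close> records whether more than
  \<open>k\<close> proposals are made. If no proposal is accepted, all terms are 1 and the series is
  infinite, as it should be.\<close>

lemma ennreal_of_enat_num_proposals:
  "ennreal_of_enat (num_proposals s) = (\<Sum>k. if \<forall>i<k. \<not> s i then 1 else 0)"
proof (cases "\<exists>k. s k")
  case True
  define n where "n = (LEAST k. s k)"
  have "s n" unfolding n_def using True by (rule LeastI_ex)
  have "(\<forall>i<k. \<not> s i) \<longleftrightarrow> k \<le> n" for k
    using \<open>s n\<close> by (auto simp: n_def dest: not_less_Least dest!: leI)
       (metis not_less_Least order_less_le_trans)
  then have "(\<Sum>k. if \<forall>i<k. \<not> s i then 1 else 0) = (\<Sum>k. if k \<in> {..n} then 1 else 0 :: ennreal)"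
    by simp
  also have "\<dots> = (\<Sum>k\<in>{..n}. 1)"
    by (subst suminf_finite [where N = "{..n}"]) auto
  finally show ?thesis
    using True by (simp add: num_proposals_def n_def)
next
  case False
  then show ?thesis
    using summable_iff_suminf_neq_top [of "\<lambda>_. 1"] summable_const_iff [of "1 :: real"]
    by (simp add: num_proposals_def)
qed

lemma suminf_geometric_ennreal:
  assumes "0 < q" "q \<le> 1"
  shows "(\<Sum>k. ennreal (1 - q) ^ k) = ennreal (1 / q)"
proof -
  have "(\<lambda>k. (1 - q) ^ k) sums (1 / (1 - (1 - q)))"
    using assms by (intro geometric_sums) auto
  then have "(\<Sum>k. ennreal ((1 - q) ^ k)) = ennreal (1 / q)"
    using assms by (intro suminf_ennreal_eq) auto
  then show ?thesis using assms by (simp add: ennreal_power)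
qed

text \<open>The mean of a geometric variable: the tail sum is integrated term by term, and by
  independence the first \<open>k\<close> proposals all fail with the \<open>k\<close>-th power of
  the failure probability.\<close>

lemma expected_num_proposals:
  assumes "prob_space A" and sets_A [measurable_cong]: "sets A = sets (count_space UNIV)"
    and q: "0 < measure A {True}"
  shows "(\<integral>\<^sup>+s. ennreal_of_enat (num_proposals s) \<partial>(\<Pi>\<^sub>M i\<in>(UNIV :: nat set). A)) =
    ennreal (1 / measure A {True})"
proof -
  interpret A: prob_space A by fact
  interpret P: product_prob_space "\<lambda>_. A" "UNIV :: nat set"
    by (unfold product_prob_space_def product_sigma_finite_def product_prob_space_axioms_def)
       (auto intro: A.sigma_finite_measure_axioms A.prob_space_axioms)
  have space_A: "space A = UNIV" using sets_eq_imp_space_eq [OF sets_A] by simp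
  let ?P = "\<Pi>\<^sub>M i\<in>(UNIV :: nat set). A"
  have F: "emeasure A {False} = ennreal (1 - measure A {True})"
  proof -
    have "{False} = space A - {True}" using space_A by auto
    then show ?thesis using A.prob_compl [of "{True}"] sets_A by (simp add: A.emeasure_eq_measure)
  qed
  have "(\<integral>\<^sup>+s. ennreal_of_enat (num_proposals s) \<partial>?P) =
      (\<integral>\<^sup>+s. (\<Sum>k. indicator {s \<in> space ?P. \<forall>i\<in>{..<k}. s i \<in> {False}} s) \<partial>?P)"
    unfolding ennreal_of_enat_num_proposals
    by (intro nn_integral_cong suminf_cong) (auto simp: indicator_def)
  also have "\<dots> = (\<Sum>k. emeasure ?P {s \<in> space ?P. \<forall>i\<in>{..<k}. s i \<in> {False}})"
    by (subst nn_integral_suminf) (simp_all add: sets_A)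
  also have "\<dots> = (\<Sum>k. ennreal (1 - measure A {True}) ^ k)"
    by (subst P.emeasure_PiM_Collect) (auto simp: sets_A F)
  also have "\<dots> = ennreal (1 / measure A {True})"
    using q by (intro suminf_geometric_ennreal) auto
  finally show ?thesis .
qed

lemma infsum_ennreal_nat:
  fixes f :: "nat \<Rightarrow> ennreal"
  shows "(\<Sum>\<^sub>\<infinity>m\<in>A. f m) = (\<Sum>m. f m * indicator A m)"
proof -
  have "(\<Sum>\<^sub>\<infinity>m\<in>A. f m) = (\<Sum>\<^sub>\<infinity>m. f m * indicator A m)"
    by (rule infsum_cong_neutral) (auto simp: indicator_def)
  also have "((\<lambda>m. f m * indicator A m) has_sum \<dots>) UNIV"
    by (intro has_sum_infsum nonneg_summable_on_complete) simp
  then have "(\<Sum>\<^sub>\<infinity>m. f m * indicator A m) = (\<Sum>m. f m * indicator A m)"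
    by (metis has_sum_imp_sums sums_unique)
  finally show ?thesis .
qed

lemma nn_integral_point_measure_nat:
  fixes A :: "nat set"
  shows "(\<integral>\<^sup>+m. g m \<partial>point_measure A f) = (\<Sum>\<^sub>\<infinity>m\<in>A. f m * g m)"
proof -
  have "(\<integral>\<^sup>+m. g m \<partial>point_measure A f) = (\<integral>\<^sup>+m. f m * g m \<partial>count_space A)"
    unfolding point_measure_def by (rule nn_integral_density) auto
  also have "\<dots> = (\<integral>\<^sup>+m. f m * g m * indicator A m \<partial>count_space UNIV)"
    by (simp add: nn_integral_count_space_indicator)
  also have "\<dots> = (\<Sum>\<^sub>\<infinity>m\<in>A. f m * g m)"
    by (simp add: nn_integral_count_space_nat infsum_ennreal_nat)
  finally show ?thesis .
qed

text \<open>With m = j + l the factor C(m,l) / m! becomes 1 / (l! j!), which leaves an exponential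
  series in j. Terms with m < l vanish through the binomial coefficient, so the truncated
  \<open>m - l\<close> does no harm. The choice x = 1 - p yields the probability of exactly l large
  jumps, x = 1 the numerator of T(n).\<close>

lemma poisson_binomial_sums:
  fixes r x :: real
  assumes "r > 0"
  shows "(\<lambda>m. pmf (poisson_pmf r) m * real (m choose l) * x ^ (m - l)) sums
    (r ^ l / fact l * exp (- r) * exp (r * x))"
proof -
  have "pmf (poisson_pmf r) (j + l) * real ((j + l) choose l) * x ^ (j + l - l) =
      r ^ l / fact l * exp (- r) * ((r * x) ^ j /\<^sub>R fact j)" for j
    using assms by (simp add: binomial_fact power_add power_mult_distrib field_simps)
  moreover have "(\<lambda>j. (r * x) ^ j /\<^sub>R fact j) sums exp (r * x)"
    by (rule exp_converges)
  ultimately have "(\<lambda>j. pmf (poisson_pmf r) (j + l) * real ((j + l) choose l) * x ^ (j + l - l)) sums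
      (r ^ l / fact l * exp (- r) * exp (r * x))"
    by (simp only: sums_mult)
  then show ?thesis
    by (subst (asm) sums_zero_iff_shift) (auto simp: binomial_eq_0)
qed

text \<open>Doubling the argument eventually at least halves \<open>f\<close>, so \<open>x f(x)\<close> does not increase along
  \<open>x\<^sub>0 2\<^sup>k\<close>; monotonicity of \<open>f\<close> fills the gaps.\<close>

lemma antimono_regularly_varying_bound:
  fixes f :: "real \<Rightarrow> real"
  assumes "regularly_varying f (- \<beta>)" "\<beta> > 1" "antimono f" "\<And>x. 0 \<le> f x" "\<And>x. f x \<le> 1"
  obtains K where "\<And>x. x \<ge> 0 \<Longrightarrow> x * f x \<le> K"
proof -
  have "((\<lambda>x. f (2 * x) / f x) \<longlongrightarrow> 2 powr - \<beta>) at_top"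
    using assms(1) by (simp add: regularly_varying_def)
  \<comment> \<open>Here \<beta> > 1 enters: the limit of the ratio is strictly below 1/2, so the
    ratio itself is eventually below 1/2.\<close>
  moreover have "2 powr - \<beta> < 2 powr (- 1 :: real)"
    using \<open>\<beta> > 1\<close> by (intro powr_less_mono) auto
  ultimately have "eventually (\<lambda>x. f (2 * x) / f x < 1 / 2) at_top"
    by (intro order_tendstoD(2)) (auto simp: powr_minus_divide)
  moreover have "eventually (\<lambda>x. 0 < f x) at_top"
    using assms(1) by (auto simp: regularly_varying_def eventually_at_top_linorder)
  ultimately have "eventually (\<lambda>x. 2 * f (2 * x) \<le> f x) at_top"
    by eventually_elim (simp add: field_simps)
  then obtain x0' where x0': "\<And>x. x \<ge> x0' \<Longrightarrow> 2 * f (2 * x) \<le> f x"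
    by (auto simp: eventually_at_top_linorder)
  define x0 where "x0 = max 1 x0'"
  have x0: "x0 > 0" "\<And>x. x \<ge> x0 \<Longrightarrow> 2 * f (2 * x) \<le> f x"
    using x0' by (auto simp: x0_def)
  have geo: "2 ^ k * f (x0 * 2 ^ k) \<le> f x0" for k :: nat
  proof (induction k)
    case (Suc k)
    have "x0 \<le> x0 * 2 ^ k" using x0(1) by simp
    then have "2 * f (2 * (x0 * 2 ^ k)) \<le> f (x0 * 2 ^ k)" by (rule x0(2))
    then have "2 ^ k * (2 * f (2 * (x0 * 2 ^ k))) \<le> 2 ^ k * f (x0 * 2 ^ k)"
      by (intro mult_left_mono) auto
    moreover have "2 ^ Suc k * f (x0 * 2 ^ Suc k) = 2 ^ k * (2 * f (2 * (x0 * 2 ^ k)))"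
      by (simp add: mult_ac)
    ultimately show ?case using Suc.IH by linarith
  qed simp
  have "x * f x \<le> 2 * x0" if "x \<ge> 0" for x
  proof (cases "x \<le> x0")
    case True
    have "x * f x \<le> x0 * 1" using True that assms(4,5) x0(1) by (intro mult_mono) auto
    then show ?thesis using x0(1) by simp
  next
    case False
    \<comment> \<open>The dyadic block containing \<open>x\<close>: \<open>x0 * 2 ^ k\<close> is at
      most \<open>x\<close>, and \<open>x\<close> is at most twice that. This factor 2 is the one in
      the bound \<open>2 * x0\<close>.\<close>
    define k where "k = nat \<lfloor>log 2 (x / x0)\<rfloor>"
    have pos: "0 \<le> log 2 (x / x0)" using False x0(1) by simp
    have "real k \<le> log 2 (x / x0)" "log 2 (x / x0) < real k + 1"
      using pos unfolding k_def by linarith+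
    then have "2 ^ k \<le> x / x0" "x / x0 < 2 ^ (k + 1)"
      using False x0(1) by (auto simp: le_log_iff log_less_iff powr_realpow powr_add)
    then have k: "x0 * 2 ^ k \<le> x" "x \<le> 2 * (x0 * 2 ^ k)"
      using x0(1) by (auto simp: field_simps)
    have "x * f x \<le> (2 * (x0 * 2 ^ k)) * f (x0 * 2 ^ k)"
      using k x0(1) assms(4) antimonoD [OF assms(3) k(1)] by (intro mult_mono) auto
    also have "\<dots> = 2 * x0 * (2 ^ k * f (x0 * 2 ^ k))" by simp
    also have "\<dots> \<le> 2 * x0 * 1"
      using geo [of k] assms(5) [of x0] x0(1) by (intro mult_left_mono) auto
    finally show ?thesis by simp
  qed
  then show thesis by (rule that)
qed

lemma card_subsets_of_subset:
  assumes "finite A" "E \<subseteq> A"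
  shows "card {b \<in> {b. b \<subseteq> A \<and> card b = l}. b \<subseteq> E} = card E choose l"
proof -
  have "{b \<in> {b. b \<subseteq> A \<and> card b = l}. b \<subseteq> E} = {b. b \<subseteq> E \<and> card b = l}"
    using \<open>E \<subseteq> A\<close> by auto
  then show ?thesis
    using finite_subset [OF \<open>E \<subseteq> A\<close> \<open>finite A\<close>] by (simp add: n_subsets)
qed

text \<open>Only the sigma-algebra of \<mu> matters, so the lemma also serves for products of
  \<open>borel\<close>, the form in which the independence of counts and jumps is expressed.\<close>

lemma sets_card_exceed:
  fixes \<mu> :: "real measure" and u :: real and m :: nat
  assumes [measurable_cong]: "sets \<mu> = sets borel"
  shows "{w \<in> space (\<Pi>\<^sub>M j\<in>{1..m}. \<mu>). l \<le> card {j \<in> {1..m}. u < w j}} \<in> sets (\<Pi>\<^sub>M j\<in>{1..m}. \<mu>)"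
proof -
  have [measurable]: "(\<lambda>w. card {j \<in> {1..m}. u < w j}) \<in>
      measurable (\<Pi>\<^sub>M j\<in>{1..m}. \<mu>) (count_space UNIV)"
    by measurable
  show ?thesis by measurable
qed

section \<open>A single proposal for a given number of jumps\<close>

text \<open>\<open>tail_pos\<close> makes the law conditional on exceeding \<open>u\<close> a
  probability measure, and \<open>le\<close> makes the family of \<open>l\<close>-subsets nonempty,
  so that the uniform choice of \<open>b\<close> is meaningful.\<close>

locale rejection_step = \<mu>: prob_space \<mu> for \<mu> :: "real measure" +
  fixes u :: real and l m :: nat
  assumes sets_\<mu> [measurable_cong]: "sets \<mu> = sets borel"
    and tail_pos: "0 < measure \<mu> {u<..}"
    and le: "l \<le> m"
begin

abbreviation (input) "iid \<equiv> \<Pi>\<^sub>M j\<in>{1..m}. \<mu>"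
abbreviation (input) "subsets \<equiv> {b. b \<subseteq> {1..m} \<and> card b = l}"
abbreviation (input) "tilted b \<equiv> \<Pi>\<^sub>M j\<in>{1..m}. if j \<in> b then uniform_measure \<mu> {u<..} else \<mu>"
abbreviation (input) "exceed w \<equiv> {j \<in> {1..m}. u < w j}"

interpretation iid: product_prob_space "\<lambda>_. \<mu>" "{1..m}"
  by (unfold product_prob_space_def product_sigma_finite_def product_prob_space_axioms_def)
     (auto intro: \<mu>.sigma_finite_measure_axioms \<mu>.prob_space_axioms)

lemma tail_emeasure: "emeasure \<mu> {u<..} = ennreal (measure \<mu> {u<..})"
  by (rule \<mu>.emeasure_eq_measure)

lemma prob_space_jump: "prob_space (if j \<in> b then uniform_measure \<mu> {u<..} else \<mu>)"
  using \<mu>.prob_space_axioms tail_pos by (auto intro!: prob_space_uniform_measure simp: tail_emeasure)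

lemma subsets: "finite subsets" "subsets \<noteq> {}" "card subsets = m choose l"
proof -
  show *: "finite subsets" by (rule finite_subset [of _ "Pow {1..m}"]) auto
  show "card subsets = m choose l" using n_subsets [of "{1..m}" l] by simp
  then show "subsets \<noteq> {}" using le by (metis card.empty zero_less_binomial not_less_iff_gr_or_eq)
qed

lemma exceed_measurable [measurable]:
  "(\<lambda>w. card (exceed w)) \<in> measurable iid (count_space UNIV)"
  by measurable

lemma exceed_sets: "{w \<in> space iid. l \<le> card (exceed w)} \<in> sets iid"
  by (rule sets_card_exceed [OF sets_\<mu>])

lemma sets_tilted: "sets (tilted b) = sets iid"
  by (rule sets_PiM_cong) (auto simp: sets_\<mu>)

lemma tilted_in_subprob: "tilted b \<in> space (subprob_algebra iid)"
proof -
  have "prob_space (tilted b)" by (rule prob_space_PiM) (rule prob_space_jump)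
  then show ?thesis
    using sets_tilted by (simp add: space_subprob_algebra prob_space_imp_subprob_space)
qed

lemma tilted_kernel [measurable]:
  "tilted \<in> measurable (measure_pmf q) (subprob_algebra iid)"
  using tilted_in_subprob by (simp del: One_nat_def)

text \<open>Each coordinate in \<open>b\<close> contributes the indicator of exceeding
  \<open>u\<close> divided by the tail probability, every other coordinate contributes 1. The
  density thus depends on \<open>b\<close> only through the condition that all of \<open>b\<close>
  exceeds, which is what makes summing over \<open>b\<close> a counting problem.\<close>

lemma tilted_density:
  assumes "b \<in> subsets"
  shows "tilted b = density iid (\<lambda>w. if b \<subseteq> exceed w then ennreal ((1 / measure \<mu> {u<..}) ^ l) else 0)"
proof -
  define f :: "nat \<Rightarrow> real \<Rightarrow> ennreal" where
    "f j = (if j \<in> b then (\<lambda>x. indicator {u<..} x / emeasure \<mu> {u<..}) else (\<lambda>_. 1))" for j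
  have jump: "density \<mu> (f j) = (if j \<in> b then uniform_measure \<mu> {u<..} else \<mu>)" for j
    by (simp add: f_def uniform_measure_def density_1)
  have "PiM {1..m} (\<lambda>j. density \<mu> (f j)) = density iid (\<lambda>w. \<Prod>j\<in>{1..m}. f j (w j))"
  proof (rule iid.PiM_density)
    show "f j \<in> borel_measurable \<mu>" for j
      by (cases "j \<in> b") (simp_all add: f_def sets_\<mu>)
    show "sigma_finite_measure (density \<mu> (f j))" for j
      unfolding jump using prob_space_jump by (rule prob_space_imp_sigma_finite)
  qed simp
  moreover have "(\<Prod>j\<in>{1..m}. f j (w j)) =
      (if b \<subseteq> exceed w then ennreal ((1 / measure \<mu> {u<..}) ^ l) else 0)" for w
  proof -
    have b: "b \<subseteq> {1..m}" "card b = l" "finite b"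
      using assms by (auto intro: finite_subset)
    have "(\<Prod>j\<in>{1..m}. f j (w j)) = (\<Prod>j\<in>b. f j (w j))"
      using b by (intro prod.mono_neutral_right) (auto simp: f_def)
    also have "\<dots> = (\<Prod>j\<in>b. if u < w j then ennreal (1 / measure \<mu> {u<..}) else 0)"
      using tail_pos
      by (intro prod.cong refl) (auto simp: f_def tail_emeasure simp flip: divide_ennreal ennreal_1)
    also have "\<dots> = (if b \<subseteq> exceed w then ennreal ((1 / measure \<mu> {u<..}) ^ l) else 0)"
    proof (cases "b \<subseteq> exceed w")
      case True
      then have "(\<Prod>j\<in>b. if u < w j then ennreal (1 / measure \<mu> {u<..}) else 0) =
          (\<Prod>j\<in>b. ennreal (1 / measure \<mu> {u<..}))"
        by (intro prod.cong) auto
      then show ?thesis using True b by (simp add: ennreal_power)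
    next
      case False
      then obtain j where "j \<in> b" "\<not> u < w j" using b by auto
      then have "(\<Prod>j\<in>b. if u < w j then ennreal (1 / measure \<mu> {u<..}) else 0) = 0"
        using b by (intro prod_zero) auto
      then show ?thesis using False by simp
    qed
    finally show ?thesis .
  qed
  ultimately show ?thesis by (simp add: jump)
qed

lemma proposal_sets: "sets (proposal \<mu> u l m) = sets iid"
  unfolding proposal_def by (rule sets_bind) (simp_all add: sets_tilted del: One_nat_def)

lemma proposal_prob_space: "prob_space (proposal \<mu> u l m)"
  unfolding proposal_def
  by (rule prob_space.prob_space_bind [OF prob_space_measure_pmf _ tilted_kernel])
     (intro AE_I2 prob_space_PiM prob_space_jump)

lemma decision_kernel:
  "(\<lambda>w. measure_pmf (bernoulli_pmf (1 / real (card (exceed w) choose l))))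
    \<in> measurable (proposal \<mu> u l m) (subprob_algebra (count_space UNIV))"
  unfolding measurable_cong_sets [OF proposal_sets refl]
  by (rule measurable_compose [OF exceed_measurable measurable_measure_pmf])

lemma accepted_sets: "sets (accepted \<mu> u l m) = sets (count_space UNIV)"
  unfolding accepted_def
  by (rule sets_bind) (auto simp: prob_space.not_empty [OF proposal_prob_space])

lemma accepted_prob_space: "prob_space (accepted \<mu> u l m)"
  unfolding accepted_def
  by (rule prob_space.prob_space_bind [OF proposal_prob_space _ decision_kernel])
     (auto intro: prob_space_measure_pmf)

text \<open>Summing the densities of the proposals over all subsets \<open>b\<close> counts the \<open>l\<close>-subsets of the set
  of exceedances, which the acceptance probability cancels.\<close>

lemma measure_accepted:
  "measure (accepted \<mu> u l m) {True} =
    measure iid {w \<in> space iid. l \<le> card (exceed w)} / (real (m choose l) * measure \<mu> {u<..} ^ l)"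
proof -
  define a where "a = (1 / measure \<mu> {u<..}) ^ l"
  define g where "g w = ennreal (1 / real (card (exceed w) choose l))" for w
  have a: "0 \<le> a" by (simp add: a_def)
  have g [measurable]: "g \<in> borel_measurable iid"
    unfolding g_def by (rule measurable_compose [OF exceed_measurable]) simp
  let ?E = "{w \<in> space iid. l \<le> card (exceed w)}"
  have sub [measurable]: "Measurable.pred iid (\<lambda>w. b \<subseteq> exceed w)" for b
  proof -
    have "(b \<subseteq> exceed w) = (\<forall>j\<in>b. j \<in> {1..m} \<and> u < w j)" for w by auto
    moreover have "Measurable.pred iid (\<lambda>w. j \<in> {1..m} \<and> u < w j)" for j
      by (cases "j \<in> {1..m}") auto
    ultimately show ?thesis by (simp add: pred_intros_countable_bounded)
  qed
  have E [measurable]: "?E \<in> sets iid" by (rule exceed_sets)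
  have "emeasure (accepted \<mu> u l m) {True} =
      (\<integral>\<^sup>+w. emeasure (measure_pmf (bernoulli_pmf (1 / real (card (exceed w) choose l)))) {True}
        \<partial>proposal \<mu> u l m)"
    unfolding accepted_def
    by (rule emeasure_bind [OF _ decision_kernel])
       (auto simp: prob_space.not_empty [OF proposal_prob_space])
  also have "\<dots> = (\<integral>\<^sup>+w. g w \<partial>proposal \<mu> u l m)"
  proof (rule nn_integral_cong)
    fix w
    \<comment> \<open>The parameter of \<open>bernoulli_pmf\<close> must lie in [0,1]. For fewer
      than \<open>l\<close> exceedances the binomial coefficient is 0 and the convention 1 / 0 = 0
      means certain rejection.\<close>
    have "1 / real k \<le> 1" for k by (cases k) auto
    then show "emeasure (measure_pmf (bernoulli_pmf (1 / real (card (exceed w) choose l)))) {True} = g w"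
      by (simp add: emeasure_pmf_single g_def del: One_nat_def)
  qed
  also have "\<dots> = (\<integral>\<^sup>+b. \<integral>\<^sup>+w. g w \<partial>tilted b \<partial>measure_pmf (pmf_of_set subsets))"
    unfolding proposal_def by (rule nn_integral_bind [OF g tilted_kernel])
  also have "\<dots> = (\<Sum>b\<in>subsets. \<integral>\<^sup>+w. g w \<partial>tilted b) / (m choose l)"
    using subsets by (simp add: nn_integral_pmf_of_set)
  also have "(\<Sum>b\<in>subsets. \<integral>\<^sup>+w. g w \<partial>tilted b) =
      (\<Sum>b\<in>subsets. \<integral>\<^sup>+w. (if b \<subseteq> exceed w then ennreal a else 0) * g w \<partial>iid)"
  proof (rule sum.cong [OF refl])
    fix b assume b: "b \<in> subsets"
    show "(\<integral>\<^sup>+w. g w \<partial>tilted b) = (\<integral>\<^sup>+w. (if b \<subseteq> exceed w then ennreal a else 0) * g w \<partial>iid)"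
      unfolding tilted_density [OF b] a_def by (intro nn_integral_density g) measurable
  qed
  also have "\<dots> = (\<integral>\<^sup>+w. (\<Sum>b\<in>subsets. (if b \<subseteq> exceed w then ennreal a else 0) * g w) \<partial>iid)"
    by (rule nn_integral_sum [symmetric]) measurable
  also have "\<dots> = (\<integral>\<^sup>+w. ennreal a * indicator ?E w \<partial>iid)"
  proof (rule nn_integral_cong)
    fix w assume w: "w \<in> space iid"
    have "(\<Sum>b\<in>subsets. (if b \<subseteq> exceed w then ennreal a else 0) * g w) =
        of_nat (card {b \<in> subsets. b \<subseteq> exceed w}) * (ennreal a * g w)"
      using subsets(1) by (simp add: sum.If_cases Int_def flip: sum_distrib_right)
         (simp add: mult.assoc)
    also have "card {b \<in> subsets. b \<subseteq> exceed w} = card (exceed w) choose l"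
      by (rule card_subsets_of_subset) auto
    also have "of_nat (card (exceed w) choose l) * (ennreal a * g w) = ennreal a * indicator ?E w"
    proof (cases "l \<le> card (exceed w)")
      case True
      then have "0 < card (exceed w) choose l" by (rule zero_less_binomial)
      then have "real (card (exceed w) choose l) * (1 / real (card (exceed w) choose l)) = 1"
        by simp
      then have "of_nat (card (exceed w) choose l) * g w = 1"
        unfolding g_def by (simp add: ennreal_of_nat_eq_real_of_nat flip: ennreal_mult)
      then show ?thesis using True w by (simp add: mult.left_commute)
    qed (use w in \<open>simp add: binomial_eq_0\<close>)
    finally show "(\<Sum>b\<in>subsets. (if b \<subseteq> exceed w then ennreal a else 0) * g w) =
        ennreal a * indicator ?E w" .
  qed
  also have "\<dots> = ennreal (a * measure iid ?E)"
    using a by (simp add: nn_integral_cmult_indicator iid.P.emeasure_eq_measure ennreal_mult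
        del: One_nat_def)
  also have "\<dots> / (m choose l) = ennreal (a * measure iid ?E / (m choose l))"
    using a le by (simp add: ennreal_of_nat_eq_real_of_nat divide_ennreal zero_less_binomial)
  finally have "measure (accepted \<mu> u l m) {True} = a * measure iid ?E / (m choose l)"
    using a by (simp add: measure_def)
  then show ?thesis by (simp add: a_def power_one_over)
qed

text \<open>The event contains the box on which all \<open>m\<close> jumps exceed. The bound of
  \<open>measure_exceed_ge\<close> would not suffice for positivity: it is 0 if every jump exceeds
  almost surely and \<open>l < m\<close>.\<close>

lemma measure_exceed_pos: "0 < measure iid {w \<in> space iid. l \<le> card (exceed w)}"
proof -
  interpret fin: finite_product_prob_space "\<lambda>_. \<mu>" "{1..m}" by standard simp
  have "0 < measure \<mu> {u<..} ^ m" using tail_pos by simp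
  also have "\<dots> = measure iid (\<Pi>\<^sub>E j\<in>{1..m}. {u<..})"
    by (subst fin.finite_measure_PiM_emb) (simp_all add: sets_\<mu>)
  also have "\<dots> \<le> measure iid {w \<in> space iid. l \<le> card (exceed w)}"
  proof (rule iid.P.finite_measure_mono [OF _ exceed_sets], rule subsetI)
    fix w assume w: "w \<in> (\<Pi>\<^sub>E j\<in>{1..m}. {u<..})"
    then have "exceed w = {1..m}" by auto
    moreover have "w \<in> space iid"
      using w sets_eq_imp_space_eq [OF sets_\<mu>] by (auto simp: space_PiM)
    ultimately show "w \<in> {w \<in> space iid. l \<le> card (exceed w)}" using le by simp
  qed
  finally show ?thesis .
qed

text \<open>The left-hand side is the probability of exactly \<open>l\<close> exceedances, obtained
  by splitting according to which coordinates exceed.\<close>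

lemma measure_exceed_ge:
  "real (m choose l) * measure \<mu> {u<..} ^ l * (1 - measure \<mu> {u<..}) ^ (m - l)
    \<le> measure iid {w \<in> space iid. l \<le> card (exceed w)}"
proof -
  interpret fin: finite_product_prob_space "\<lambda>_. \<mu>" "{1..m}" by standard simp
  let ?p = "measure \<mu> {u<..}"
  have space_\<mu>: "space \<mu> = UNIV" using sets_eq_imp_space_eq [OF sets_\<mu>] by simp
  \<comment> \<open>The box on which the exceeding coordinates are precisely those in
    \<open>b\<close>; hence boxes for different \<open>b\<close> are disjoint.\<close>
  define A where "A b = (\<Pi>\<^sub>E j\<in>{1..m}. if j \<in> b then {u<..} else {..u})" for b
  have exceed: "exceed w = b" if "w \<in> A b" "b \<in> subsets" for w b
    using that by (force simp: A_def PiE_iff split: if_splits)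
  have disjoint: "disjoint_family_on A subsets"
    unfolding disjoint_family_on_def
  proof (intro ballI impI)
    fix b c assume "b \<in> subsets" "c \<in> subsets" "b \<noteq> c"
    then show "A b \<inter> A c = {}"
      using exceed [of _ b] exceed [of _ c] by (metis disjoint_iff)
  qed
  have le_u: "measure \<mu> {..u} = 1 - ?p"
    using \<mu>.prob_compl [of "{u<..}"] by (simp add: sets_\<mu> space_\<mu> flip: Compl_eq_Diff_UNIV)
  have A_sets: "A b \<in> sets iid" for b
    unfolding A_def by (rule sets_PiM_I_finite) (auto simp: sets_\<mu>)
  have A: "measure iid (A b) = ?p ^ l * (1 - ?p) ^ (m - l)" if "b \<in> subsets" for b
  proof -
    have b: "b \<subseteq> {1..m}" "card b = l" "finite b" using that by (auto intro: finite_subset)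
    have "measure iid (A b) = (\<Prod>j\<in>{1..m}. if j \<in> b then ?p else 1 - ?p)"
      unfolding A_def by (subst fin.finite_measure_PiM_emb) (auto simp: sets_\<mu> le_u intro!: prod.cong)
    also have "\<dots> = ?p ^ card ({1..m} \<inter> b) * (1 - ?p) ^ card ({1..m} - b)"
      by (simp add: prod.If_cases Diff_eq)
    also have "{1..m} \<inter> b = b" using b by auto
    also have "card ({1..m} - b) = m - l" using b by (simp add: card_Diff_subset)
    finally show ?thesis using b by simp
  qed
  have "real (m choose l) * ?p ^ l * (1 - ?p) ^ (m - l) = (\<Sum>b\<in>subsets. ?p ^ l * (1 - ?p) ^ (m - l))"
    using subsets(3) by (simp add: mult.assoc)
  also have "\<dots> = (\<Sum>b\<in>subsets. measure iid (A b))"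
    by (intro sum.cong refl A [symmetric])
  also have "\<dots> = measure iid (\<Union>b\<in>subsets. A b)"
    using subsets(1) A_sets
    by (intro iid.P.finite_measure_finite_Union [symmetric] disjoint) (auto simp del: One_nat_def)
  also have "\<dots> \<le> measure iid {w \<in> space iid. l \<le> card (exceed w)}"
  proof (rule iid.P.finite_measure_mono [OF _ exceed_sets], rule subsetI)
    fix w assume "w \<in> (\<Union>b\<in>subsets. A b)"
    then obtain b where b: "b \<in> subsets" "w \<in> A b" by blast
    then show "w \<in> {w \<in> space iid. l \<le> card (exceed w)}"
      using exceed [OF b(2,1)] sets.sets_into_space [OF A_sets] by auto
  qed
  finally show ?thesis .
qed

end

section \<open>Conditioning on large jumps and the mean running time for fixed n\<close>

lemma (in prob_space) distr_iid_eq_PiM: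
  fixes W :: "nat \<Rightarrow> 'a \<Rightarrow> real"
  assumes indep: "indep_vars (\<lambda>_. borel) W {1..}"
    and ident: "\<And>k. k \<ge> 1 \<Longrightarrow> distr M borel (W k) = \<mu>"
  shows "distr M (\<Pi>\<^sub>M j\<in>{1..m}. \<mu>) (\<lambda>\<omega>. \<lambda>j\<in>{1..m}. W j \<omega>) = (\<Pi>\<^sub>M j\<in>{1..m}. \<mu>)"
proof -
  have W [measurable]: "W k \<in> borel_measurable M" if "k \<ge> 1" for k
    using indep that by (auto simp: indep_vars_def)
  have sets_\<mu> [measurable_cong]: "sets \<mu> = sets borel"
    using ident [of 1] by (metis order_refl sets_distr)
  have "prob_space \<mu>" using ident [of 1] W [of 1] by (metis order_refl prob_space_distr)
  then interpret iid: product_prob_space "\<lambda>_. \<mu>" "{1..m}"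
    by (unfold product_prob_space_def product_sigma_finite_def product_prob_space_axioms_def)
       (auto intro: prob_space_imp_sigma_finite)
  have meas: "(\<lambda>\<omega>. \<lambda>j\<in>{1..m}. W j \<omega>) \<in> measurable M (\<Pi>\<^sub>M j\<in>{1..m}. \<mu>)"
    by (rule measurable_restrict) (use W sets_\<mu> in \<open>simp cong: measurable_cong_sets\<close>)
  show ?thesis
  proof (rule iid.PiM_eqI)
    fix A :: "nat \<Rightarrow> real set" assume A: "\<And>j. j \<in> {1..m} \<Longrightarrow> A j \<in> sets \<mu>"
    have "emeasure (distr M (\<Pi>\<^sub>M j\<in>{1..m}. \<mu>) (\<lambda>\<omega>. \<lambda>j\<in>{1..m}. W j \<omega>)) (Pi\<^sub>E {1..m} A) =
        emeasure M ((\<lambda>\<omega>. \<lambda>j\<in>{1..m}. W j \<omega>) -` Pi\<^sub>E {1..m} A \<inter> space M)"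
      using A by (intro emeasure_distr meas sets_PiM_I_finite) auto
    also have "\<dots> = (\<Prod>j\<in>{1..m}. emeasure \<mu> (A j))"
    \<comment> \<open>For \<open>m = 0\<close> the intersection over \<open>{1..m}\<close> would be
      \<open>UNIV\<close> instead of \<open>space M\<close>. In that case the product space has one
      point and both sides are 1.\<close>
    proof (cases "m = 0")
      case False
      have "(\<lambda>\<omega>. \<lambda>j\<in>{1..m}. W j \<omega>) -` Pi\<^sub>E {1..m} A \<inter> space M =
          (\<Inter>j\<in>{1..m}. W j -` A j \<inter> space M)"
        using False by (auto simp: PiE_iff)
      also have "emeasure M \<dots> = ennreal (\<Prod>j\<in>{1..m}. prob (W j -` A j \<inter> space M))"
        using False A sets_\<mu> unfolding emeasure_eq_measure
        by (subst indep_varsD [OF indep]) auto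
      also have "\<dots> = (\<Prod>j\<in>{1..m}. emeasure M (W j -` A j \<inter> space M))"
        by (simp add: emeasure_eq_measure prod_ennreal)
      also have "\<dots> = (\<Prod>j\<in>{1..m}. emeasure \<mu> (A j))"
      proof (rule prod.cong [OF refl])
        fix j assume j: "j \<in> {1..m}"
        then have "emeasure M (W j -` A j \<inter> space M) = emeasure (distr M borel (W j)) (A j)"
          using A [OF j] sets_\<mu> by (intro emeasure_distr [symmetric] W) auto
        then show "emeasure M (W j -` A j \<inter> space M) = emeasure \<mu> (A j)"
          using j by (simp add: ident)
      qed
      finally show ?thesis .
    qed (simp add: emeasure_space_1 vimage_def restrict_def)
    finally show "emeasure (distr M (\<Pi>\<^sub>M j\<in>{1..m}. \<mu>) (\<lambda>\<omega>. \<lambda>j\<in>{1..m}. W j \<omega>)) (Pi\<^sub>E {1..m} A) =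
        (\<Prod>j\<in>{1..m}. emeasure \<mu> (A j))" .
  qed simp_all
qed

text \<open>The setting for one fixed \<open>n\<close>, with \<open>r\<close> the mean number of
  jumps up to time \<open>n\<close>. \<open>N_W_indep\<close> pairs the event of exactly
  \<open>m\<close> jumps with the first \<open>m\<close> jump sizes, because on that event these
  sizes decide whether \<open>B\<close> occurs.\<close>

locale compound_poisson_jumps = prob_space M for M :: "'a measure" +
  fixes N :: "real \<Rightarrow> 'a \<Rightarrow> nat" and W :: "nat \<Rightarrow> 'a \<Rightarrow> real" and r \<gamma> :: real and l n :: nat
  assumes r: "r > 0"
    and N [measurable]: "N (real n) \<in> measurable M (count_space UNIV)"
    and poisson: "\<And>m. prob {\<omega> \<in> space M. N (real n) \<omega> = m} = pmf (poisson_pmf r) m"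
    and W_indep: "indep_vars (\<lambda>_. borel) W {1..}"
    and W_ident: "\<And>k. k \<ge> 1 \<Longrightarrow> distr M borel (W k) = distr M borel (W 1)"
    and N_W_indep: "\<And>m S. S \<in> sets (\<Pi>\<^sub>M j\<in>{1..m}. (borel :: real measure)) \<Longrightarrow>
      prob {\<omega> \<in> space M. N (real n) \<omega> = m \<and> (\<lambda>j\<in>{1..m}. W j \<omega>) \<in> S} =
      prob {\<omega> \<in> space M. N (real n) \<omega> = m} * prob {\<omega> \<in> space M. (\<lambda>j\<in>{1..m}. W j \<omega>) \<in> S}"
    and tail_pos: "0 < \<P>(\<omega> in M. real n * \<gamma> < W 1 \<omega>)"
begin

abbreviation (input) "p \<equiv> \<P>(\<omega> in M. real n * \<gamma> < W 1 \<omega>)"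
abbreviation (input) "\<mu> \<equiv> distr M borel (W 1)"
abbreviation (input) "B \<equiv> large_jumps_event M N W \<gamma> l n"
abbreviation (input) "exceed_prob m \<equiv>
  prob {\<omega> \<in> space M. l \<le> card {k \<in> {1..m}. real n * \<gamma> < W k \<omega>}}"

lemma W_measurable: "k \<ge> 1 \<Longrightarrow> W k \<in> borel_measurable M"
  using W_indep by (auto simp: indep_vars_def)

lemma prob_space_\<mu>: "prob_space \<mu>"
  by (rule prob_space_distr) (simp add: W_measurable)

lemma tail_\<mu>: "measure \<mu> {real n * \<gamma><..} = p"
  by (subst measure_distr) (auto simp: W_measurable intro!: arg_cong [where f = prob])

abbreviation (input) "iid (m :: nat) \<equiv> \<Pi>\<^sub>M j\<in>{1..m}. \<mu>"
abbreviation (input) "iid_exceed (m :: nat) \<equiv>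
  {w \<in> space (iid m). l \<le> card {j \<in> {1..m}. real n * \<gamma> < w j}}"

lemma jumps_measurable: "(\<lambda>\<omega>. \<lambda>j\<in>{1..m}. W j \<omega>) \<in> measurable M (iid m)"
  by (rule measurable_restrict) (use W_measurable in auto)

lemma iid_exceed_sets: "iid_exceed m \<in> sets (iid m)"
  by (rule sets_card_exceed) simp

lemma vimage_iid_exceed:
  "(\<lambda>\<omega>. \<lambda>j\<in>{1..m}. W j \<omega>) -` iid_exceed m \<inter> space M =
    {\<omega> \<in> space M. l \<le> card {k \<in> {1..m}. real n * \<gamma> < W k \<omega>}}"
proof -
  have "{j \<in> {1..m}. real n * \<gamma> < (\<lambda>j\<in>{1..m}. W j \<omega>) j} = {j \<in> {1..m}. real n * \<gamma> < W j \<omega>}" for \<omega>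
    by auto
  then show ?thesis
    using measurable_space [OF jumps_measurable] by (auto simp only: vimage_def)
qed

lemma exceed_prob_eq: "exceed_prob m = measure (iid m) (iid_exceed m)"
proof -
  have "measure (iid m) (iid_exceed m) =
      measure (distr M (iid m) (\<lambda>\<omega>. \<lambda>j\<in>{1..m}. W j \<omega>)) (iid_exceed m)"
    using distr_iid_eq_PiM [OF W_indep W_ident] by simp
  also have "\<dots> = exceed_prob m"
    unfolding measure_distr [OF jumps_measurable iid_exceed_sets] vimage_iid_exceed ..
  finally show ?thesis ..
qed

text \<open>Once the count is fixed to \<open>m\<close>, the random index range in \<open>B\<close>
  becomes \<open>{1..m}\<close>, and independence splits the probability into two factors.\<close>

lemma prob_N_and_large_jumps:
  "prob {\<omega> \<in> space M. N (real n) \<omega> = m \<and> \<omega> \<in> B} = pmf (poisson_pmf r) m * exceed_prob m"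
proof -
  let ?S = "{w \<in> space (\<Pi>\<^sub>M j\<in>{1..m}. (borel :: real measure)). l \<le> card {j \<in> {1..m}. real n * \<gamma> < w j}}"
  have cong: "{j \<in> {1..m}. real n * \<gamma> < (\<lambda>j\<in>{1..m}. W j \<omega>) j} = {j \<in> {1..m}. real n * \<gamma> < W j \<omega>}" for \<omega>
    by auto
  have S: "((\<lambda>j\<in>{1..m}. W j \<omega>) \<in> ?S) = (l \<le> card {k \<in> {1..m}. real n * \<gamma> < W k \<omega>})" for \<omega>
    by (simp only: mem_Collect_eq cong) (simp add: space_PiM)
  have "prob {\<omega> \<in> space M. N (real n) \<omega> = m \<and> (\<lambda>j\<in>{1..m}. W j \<omega>) \<in> ?S} =
      prob {\<omega> \<in> space M. N (real n) \<omega> = m} * prob {\<omega> \<in> space M. (\<lambda>j\<in>{1..m}. W j \<omega>) \<in> ?S}"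
    by (rule N_W_indep [OF sets_card_exceed [OF refl]])
  moreover have "{\<omega> \<in> space M. N (real n) \<omega> = m \<and> \<omega> \<in> B} =
      {\<omega> \<in> space M. N (real n) \<omega> = m \<and> l \<le> card {k \<in> {1..m}. real n * \<gamma> < W k \<omega>}}"
    by (auto simp: large_jumps_event_def)
  ultimately show ?thesis by (simp only: S poisson)
qed

lemma large_jumps_event_measurable [measurable]: "B \<in> events"
proof -
  have eq: "B = (\<Union>m. (N (real n) -` {m} \<inter> space M) \<inter>
      {\<omega> \<in> space M. l \<le> card {k \<in> {1..m}. real n * \<gamma> < W k \<omega>}})"
    by (auto simp: large_jumps_event_def)
  have N_event: "N (real n) -` {m} \<inter> space M \<in> events" for m
    by (rule measurable_sets [OF N]) simp
  have W_event: "{\<omega> \<in> space M. l \<le> card {k \<in> {1..m}. real n * \<gamma> < W k \<omega>}} \<in> events" for m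
    using measurable_sets [OF jumps_measurable iid_exceed_sets] unfolding vimage_iid_exceed .
  show ?thesis
    unfolding eq by (intro sets.countable_UN image_subsetI sets.Int N_event W_event)
qed

lemma tail_\<mu>_pos: "0 < measure \<mu> {real n * \<gamma><..}"
  unfolding tail_\<mu> by (rule tail_pos)

lemma rejection_step_\<mu>: "l \<le> m \<Longrightarrow> rejection_step \<mu> (real n * \<gamma>) l m"
  using prob_space_\<mu> tail_\<mu>_pos by (simp add: rejection_step_def rejection_step_axioms_def)

lemma exceed_prob_pos: "l \<le> m \<Longrightarrow> 0 < exceed_prob m"
  unfolding exceed_prob_eq by (rule rejection_step.measure_exceed_pos [OF rejection_step_\<mu>])

lemma exceed_prob_ge:
  assumes "l \<le> m"
  shows "real (m choose l) * p ^ l * (1 - p) ^ (m - l) \<le> exceed_prob m"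
  using rejection_step.measure_exceed_ge [OF rejection_step_\<mu> [OF assms]]
  unfolding exceed_prob_eq tail_\<mu> .

text \<open>Poisson thinning in series form: given m jumps, B is at least as likely as exactly l
  large ones, and summing these bounds with Poisson weights gives the mass at l of the Poisson law
  with mean r p, since exp(-r) exp(r (1 - p)) = exp(-r p).\<close>

lemma prob_large_jumps_ge: "(r * p) ^ l / fact l * exp (- (r * p)) \<le> prob B"
proof -
  let ?lb = "\<lambda>m. pmf (poisson_pmf r) m * real (m choose l) * (1 - p) ^ (m - l) * p ^ l"
  have "?lb sums (r ^ l / fact l * exp (- r) * exp (r * (1 - p)) * p ^ l)"
    by (intro sums_mult2 poisson_binomial_sums r)
  also have "r ^ l / fact l * exp (- r) * exp (r * (1 - p)) * p ^ l =
      (r * p) ^ l / fact l * exp (- (r * p))"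
    by (simp add: power_mult_distrib algebra_simps flip: exp_add)
  finally have lb: "?lb sums ((r * p) ^ l / fact l * exp (- (r * p)))" .
  have "(\<lambda>m. prob {\<omega> \<in> space M. N (real n) \<omega> = m \<and> \<omega> \<in> B}) sums
      prob (\<Union>m. {\<omega> \<in> space M. N (real n) \<omega> = m \<and> \<omega> \<in> B})"
    by (rule finite_measure_UNION) (auto simp: disjoint_family_on_def)
  also have "(\<Union>m. {\<omega> \<in> space M. N (real n) \<omega> = m \<and> \<omega> \<in> B}) = B"
    by (auto simp: large_jumps_event_def)
  finally have B: "(\<lambda>m. pmf (poisson_pmf r) m * exceed_prob m) sums prob B"
    by (simp only: prob_N_and_large_jumps)
  have "?lb m \<le> pmf (poisson_pmf r) m * exceed_prob m" for m
  proof (cases "l \<le> m")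
    case True
    then have "pmf (poisson_pmf r) m * (real (m choose l) * p ^ l * (1 - p) ^ (m - l)) \<le>
        pmf (poisson_pmf r) m * exceed_prob m"
      by (intro mult_left_mono exceed_prob_ge pmf_nonneg)
    then show ?thesis by (simp only: mult_ac)
  qed (simp add: binomial_eq_0)
  then show ?thesis by (rule sums_le [OF _ lb B])
qed

text \<open>Since \<open>r > 0\<close>, every count \<open>m\<close> has positive Poisson
  probability, so this probability cancels in the conditional one and no division by zero is hidden
  in it.\<close>

lemma mean_proposals_eq:
  "mean_proposals M N W \<gamma> l n m = real (m choose l) * p ^ l / exceed_prob m"
proof -
  have "0 < pmf (poisson_pmf r) m" using r by simp
  then have "\<P>(\<omega> in M. \<omega> \<in> B \<bar> N (real n) \<omega> = m) = exceed_prob m"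
    using prob_N_and_large_jumps [of m] unfolding cond_prob_def poisson
    by (simp add: conj_commute)
  then show ?thesis by (simp add: mean_proposals_def)
qed

lemma weighted_mean_proposals_eq:
  assumes "l \<le> m"
  shows "jump_count_weight M N W \<gamma> l n m * mean_proposals M N W \<gamma> l n m =
    pmf (poisson_pmf r) m * real (m choose l) * p ^ l / prob B"
proof -
  have "{\<omega> \<in> space M. \<omega> \<in> B} = B" by (auto simp: large_jumps_event_def)
  then have "jump_count_weight M N W \<gamma> l n m = pmf (poisson_pmf r) m * exceed_prob m / prob B"
    unfolding jump_count_weight_def cond_prob_def prob_N_and_large_jumps by simp
  then show ?thesis
    using exceed_prob_pos [OF assms] unfolding mean_proposals_eq by simp
qed

lemma mean_running_time_le: "mean_running_time M N W \<gamma> l n \<le> ennreal (exp (r * p))"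
proof -
  have pos: "0 < (r * p) ^ l / fact l * exp (- (r * p))" using r tail_pos by simp
  then have B: "0 < prob B" using prob_large_jumps_ge by linarith
  \<comment> \<open>The series with x = 1, where the exponentials cancel: this is the binomial
    moment of the number of large jumps, divided by the probability of \<open>B\<close>.\<close>
  have "r ^ l / fact l * exp (- r) * exp (r * 1) * (p ^ l / prob B) =
      (r * p) ^ l / fact l / prob B"
    by (simp add: power_mult_distrib exp_minus field_simps)
  with sums_mult2 [OF poisson_binomial_sums [OF r, of l 1], of "p ^ l / prob B"]
  have "(\<lambda>m. pmf (poisson_pmf r) m * real (m choose l) * 1 ^ (m - l) * (p ^ l / prob B)) sums
      ((r * p) ^ l / fact l / prob B)"
    by (simp only:)
  then have s: "(\<lambda>m. pmf (poisson_pmf r) m * real (m choose l) * p ^ l / prob B) sums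
      ((r * p) ^ l / fact l / prob B)"
    by simp
  have "mean_running_time M N W \<gamma> l n =
      (\<Sum>\<^sub>\<infinity>m\<in>{l..}. ennreal (pmf (poisson_pmf r) m * real (m choose l) * p ^ l / prob B))"
    unfolding mean_running_time_def by (intro infsum_cong) (simp add: weighted_mean_proposals_eq)
  also have "\<dots> = (\<Sum>m. ennreal (pmf (poisson_pmf r) m * real (m choose l) * p ^ l / prob B))"
    unfolding infsum_ennreal_nat
    by (intro suminf_cong) (simp add: indicator_def binomial_eq_0)
  also have "\<dots> = ennreal ((r * p) ^ l / fact l / prob B)"
    using s by (intro suminf_ennreal_eq) (auto simp: pmf_nonneg)
  also have "\<dots> \<le> ennreal (exp (r * p))"
  proof (rule ennreal_leI)
    show "(r * p) ^ l / fact l / prob B \<le> exp (r * p)"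
      using prob_large_jumps_ge B by (simp add: exp_minus field_simps)
  qed
  finally show ?thesis .
qed

text \<open>Both sides average over \<open>m\<close> with the same weights, so it is enough to
  compare them for each \<open>m\<close>; there the acceptance probability is the reciprocal of
  \<open>mean_proposals\<close>.\<close>

lemma sampler_expected_proposals_eq:
  "sampler_expected_proposals M N W \<gamma> l n = mean_running_time M N W \<gamma> l n"
  unfolding sampler_expected_proposals_def mean_running_time_def nn_integral_point_measure_nat
proof (rule infsum_cong)
  fix m assume "m \<in> {l..}"
  then have m: "l \<le> m" by simp
  let ?A = "accepted \<mu> (real n * \<gamma>) l m"
  interpret step: rejection_step \<mu> "real n * \<gamma>" l m by (rule rejection_step_\<mu> [OF m])
  have acc: "measure ?A {True} = exceed_prob m / (real (m choose l) * p ^ l)"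
    using step.measure_accepted unfolding exceed_prob_eq tail_\<mu> .
  have weight_nonneg: "0 \<le> jump_count_weight M N W \<gamma> l n m"
    and proposals_nonneg: "0 \<le> mean_proposals M N W \<gamma> l n m"
    by (simp_all add: jump_count_weight_def mean_proposals_def cond_prob_def)
  \<comment> \<open>Positivity is essential here: with acceptance probability 0 the expected number
    of proposals is infinite, whereas the real quotient 1 / 0 is 0.\<close>
  have "0 < measure ?A {True}"
    unfolding acc using exceed_prob_pos [OF m] m tail_pos by (simp add: zero_less_binomial)
  then have "(\<integral>\<^sup>+s. ennreal_of_enat (num_proposals s) \<partial>(\<Pi>\<^sub>M i\<in>(UNIV :: nat set). ?A)) =
      ennreal (1 / measure ?A {True})"
    by (intro expected_num_proposals step.accepted_prob_space step.accepted_sets)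
  also have "1 / measure ?A {True} = mean_proposals M N W \<gamma> l n m"
    unfolding acc mean_proposals_eq by simp
  finally show "ennreal (jump_count_weight M N W \<gamma> l n m) *
      (\<integral>\<^sup>+s. ennreal_of_enat (num_proposals s) \<partial>(\<Pi>\<^sub>M i\<in>(UNIV :: nat set). ?A)) =
      ennreal (jump_count_weight M N W \<gamma> l n m * mean_proposals M N W \<gamma> l n m)"
    by (simp only: ennreal_mult [OF weight_nonneg proposals_nonneg])
qed

end

section \<open>From the process to the fixed-n setting, and uniformity in n\<close>

theorem proposition3p1:
  fixes M :: "'a measure"
    and N :: "real \<Rightarrow> 'a \<Rightarrow> nat"
    and W :: "nat \<Rightarrow> 'a \<Rightarrow> real"
    and rate \<beta> \<gamma> :: real
    and l :: nat
  assumes "prob_space M"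
    and "rate > 0"
    and "poisson_process M rate N"
    and "prob_space.indep_vars M (\<lambda>_. borel) W {1..}"
    and "\<And>k. k \<ge> 1 \<Longrightarrow> distr M borel (W k) = distr M borel (W 1)"
    and "\<And>k. k \<ge> 1 \<Longrightarrow> AE \<omega> in M. W k \<omega> > 0"
    and "prob_space.indep_set M
           (sets (vimage_algebra (space M) (\<lambda>\<omega>. \<lambda>t\<in>{0::real..}. N t \<omega>)
              (\<Pi>\<^sub>M t\<in>{0..}. (count_space UNIV :: nat measure))))
           (sets (vimage_algebra (space M) (\<lambda>\<omega>. \<lambda>k\<in>{1::nat..}. W k \<omega>)
              (\<Pi>\<^sub>M k\<in>{1..}. (borel :: real measure))))"
    and "\<beta> > 1"
    and "regularly_varying (\<lambda>x. \<P>(\<omega> in M. W 1 \<omega> > x)) (- \<beta>)"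
    and "\<gamma> > 0"
  shows "(\<forall>n\<ge>1. sampler_expected_proposals M N W \<gamma> l n = mean_running_time M N W \<gamma> l n) \<and>
         (SUP n\<in>{1..}. mean_running_time M N W \<gamma> l n) < \<infinity>"
proof -
  interpret prob_space M by fact
  let ?tail = "\<lambda>x. \<P>(\<omega> in M. W 1 \<omega> > x)"
  have W1 [measurable]: "W 1 \<in> borel_measurable M"
    using assms(4) by (auto simp: indep_vars_def)
  have anti: "antimono ?tail"
    by (rule antimonoI, rule finite_measure_mono) (force, measurable)
  obtain a where a: "\<And>x. x \<ge> a \<Longrightarrow> 0 < ?tail x"
    using assms(9) unfolding regularly_varying_def by blast
  \<comment> \<open>Regular variation gives positivity beyond \<open>a\<close>; as the tail is
    decreasing, it is positive at every smaller argument too.\<close>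
  have tail_pos: "0 < ?tail x" for x
    using a [of "max a x"] antimonoD [OF anti, of x "max a x"] by simp
  obtain K where K: "\<And>x. x \<ge> 0 \<Longrightarrow> x * ?tail x \<le> K"
    using antimono_regularly_varying_bound [OF assms(9,8) anti measure_nonneg prob_le_1] by blast
  have rate_pos: "0 < rate * real n" if "n \<ge> 1" for n
    using assms(2) that by simp
  have N_meas: "N t \<in> measurable M (count_space UNIV)" if "t \<ge> 0" for t
    using assms(3) that by (simp add: poisson_process_def)
  have N0: "AE \<omega> in M. N 0 \<omega> = 0"
    using assms(3) by (simp add: poisson_process_def)
  have poisson: "prob {\<omega> \<in> space M. N (real n) \<omega> = m} = pmf (poisson_pmf (rate * real n)) m"
    if "n \<ge> 1" for n m
  proof -
    have [measurable]: "N (real n) \<in> measurable M (count_space UNIV)" "N 0 \<in> measurable M (count_space UNIV)"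
      using N_meas by auto
    have "distr M (count_space UNIV) (\<lambda>\<omega>. N (real n) \<omega> - N 0 \<omega>) =
        measure_pmf (poisson_pmf (rate * (real n - 0)))"
      using assms(3) that unfolding poisson_process_def by simp
    then have "pmf (poisson_pmf (rate * real n)) m =
        measure (distr M (count_space UNIV) (\<lambda>\<omega>. N (real n) \<omega> - N 0 \<omega>)) {m}"
      by (simp add: measure_pmf_single)
    also have "\<dots> = prob ((\<lambda>\<omega>. N (real n) \<omega> - N 0 \<omega>) -` {m} \<inter> space M)"
      by (rule measure_distr) simp_all
    \<comment> \<open>The increment over [0,n] is the count itself up to a null set, because the
      process starts at 0 almost surely.\<close>
    also have "\<dots> = prob {\<omega> \<in> space M. N (real n) \<omega> = m}"
      using N0 by (intro finite_measure_eq_AE) auto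
    finally show ?thesis ..
  qed
  have indep: "prob {\<omega> \<in> space M. N (real n) \<omega> = m \<and> (\<lambda>j\<in>{1..m}. W j \<omega>) \<in> S} =
      prob {\<omega> \<in> space M. N (real n) \<omega> = m} * prob {\<omega> \<in> space M. (\<lambda>j\<in>{1..m}. W j \<omega>) \<in> S}"
    if S: "S \<in> sets (\<Pi>\<^sub>M j\<in>{1..m}. (borel :: real measure))" for n m S
  proof -
    let ?PN = "\<Pi>\<^sub>M t\<in>{0::real..}. (count_space UNIV :: nat measure)"
    let ?PW = "\<Pi>\<^sub>M k\<in>{1::nat..}. (borel :: real measure)"
    \<comment> \<open>Independence is assumed between the sigma-algebras of the whole path and of
      the whole jump sequence, so both events are exhibited as preimages of cylinder sets: the path
      by its value at \<open>n\<close>, the sequence by its restriction to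
      \<open>{1..m}\<close>.\<close>
    have "(\<lambda>f. f (real n)) -` {m} \<inter> space ?PN \<in> sets ?PN"
      by (rule measurable_sets [OF measurable_component_singleton]) auto
    then have "(\<lambda>\<omega>. \<lambda>t\<in>{0::real..}. N t \<omega>) -` ((\<lambda>f. f (real n)) -` {m} \<inter> space ?PN) \<inter> space M
        \<in> sets (vimage_algebra (space M) (\<lambda>\<omega>. \<lambda>t\<in>{0::real..}. N t \<omega>) ?PN)"
      by (rule in_vimage_algebra)
    moreover have "(\<lambda>\<omega>. \<lambda>t\<in>{0::real..}. N t \<omega>) -` ((\<lambda>f. f (real n)) -` {m} \<inter> space ?PN) \<inter> space M
        = {\<omega> \<in> space M. N (real n) \<omega> = m}"
      by (auto simp: space_PiM)
    moreover have "(\<lambda>f. restrict f {1..m}) -` S \<inter> space ?PW \<in> sets ?PW"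
      by (rule measurable_sets [OF measurable_restrict_subset S]) auto
    then have "(\<lambda>\<omega>. \<lambda>k\<in>{1::nat..}. W k \<omega>) -` ((\<lambda>f. restrict f {1..m}) -` S \<inter> space ?PW) \<inter> space M
        \<in> sets (vimage_algebra (space M) (\<lambda>\<omega>. \<lambda>k\<in>{1::nat..}. W k \<omega>) ?PW)"
      by (rule in_vimage_algebra)
    moreover have "restrict (\<lambda>k\<in>{1::nat..}. W k \<omega>) {1..m} = (\<lambda>j\<in>{1..m}. W j \<omega>)" for \<omega>
      by (auto simp: restrict_def)
    then have "(\<lambda>\<omega>. \<lambda>k\<in>{1::nat..}. W k \<omega>) -` ((\<lambda>f. restrict f {1..m}) -` S \<inter> space ?PW) \<inter> space M
        = {\<omega> \<in> space M. (\<lambda>j\<in>{1..m}. W j \<omega>) \<in> S}"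
      by (auto simp: space_PiM vimage_def)
    ultimately have "prob ({\<omega> \<in> space M. N (real n) \<omega> = m} \<inter> {\<omega> \<in> space M. (\<lambda>j\<in>{1..m}. W j \<omega>) \<in> S}) =
      prob {\<omega> \<in> space M. N (real n) \<omega> = m} * prob {\<omega> \<in> space M. (\<lambda>j\<in>{1..m}. W j \<omega>) \<in> S}"
      by (intro indep_setD [OF assms(7)]) simp_all
    moreover have "{\<omega> \<in> space M. N (real n) \<omega> = m} \<inter> {\<omega> \<in> space M. (\<lambda>j\<in>{1..m}. W j \<omega>) \<in> S} =
        {\<omega> \<in> space M. N (real n) \<omega> = m \<and> (\<lambda>j\<in>{1..m}. W j \<omega>) \<in> S}"
      by auto
    ultimately show ?thesis by simp
  qed
  have jumps: "compound_poisson_jumps M N W (rate * real n) \<gamma> n" if "n \<ge> 1" for n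
    using rate_pos [OF that] N_meas [OF of_nat_0_le_iff] poisson [OF that] assms(4,5) indep tail_pos
    by (rule compound_poisson_jumps.intro
        [OF prob_space_axioms compound_poisson_jumps_axioms.intro])
  have "sampler_expected_proposals M N W \<gamma> l n = mean_running_time M N W \<gamma> l n" if "n \<ge> 1" for n
    by (rule compound_poisson_jumps.sampler_expected_proposals_eq [OF jumps [OF that]])
  moreover have "mean_running_time M N W \<gamma> l n \<le> ennreal (exp (rate / \<gamma> * K))" if "n \<ge> 1" for n
  proof -
    have "mean_running_time M N W \<gamma> l n \<le> ennreal (exp (rate * real n * ?tail (real n * \<gamma>)))"
      by (rule compound_poisson_jumps.mean_running_time_le [OF jumps [OF that]])
    \<comment> \<open>Multiplying and dividing by \<gamma> brings in the product of the argument
      \<open>real n * \<gamma>\<close> with the tail at that same argument, which \<open>K\<close>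
      bounds independently of \<open>n\<close>.\<close>
    also have "rate * real n * ?tail (real n * \<gamma>) = rate / \<gamma> * (real n * \<gamma> * ?tail (real n * \<gamma>))"
      using assms(10) by simp
    also have "ennreal (exp \<dots>) \<le> ennreal (exp (rate / \<gamma> * K))"
      using assms(2,10) K [of "real n * \<gamma>"]
      by (intro ennreal_leI) (simp only: exp_le_cancel_iff, intro mult_left_mono, auto)
    finally show ?thesis .
  qed
  then have "(SUP n\<in>{1..}. mean_running_time M N W \<gamma> l n) \<le> ennreal (exp (rate / \<gamma> * K))"
    by (intro SUP_least) simp
  then have "(SUP n\<in>{1..}. mean_running_time M N W \<gamma> l n) < \<infinity>"
    by (rule order_le_less_trans) simp
  ultimately show ?thesis by blast
qed

end
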